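(* Let $\mathcal{A}=\{A_i\}_{i\in\Lambda}$ be a finite family of $GL_{d+1}(\mathbb{R})$ matrices, and let $\Phi_{\mathcal{A}}=\{\varphi_{A_i}\}_{i\in\Lambda}$ be the induced IFS on the unit sphere $\mathbb{S}^d$. If $\Phi_{\mathcal{A}}$ satisfies the strong exponential separation condition on a nonempty set, then $\mathcal{A}$ is strongly Diophantine.
   Context: $\varphi_A(x)=A\cdot x=Ax/\|Ax\|$ for unit vectors $x\in\mathbb{S}^d$; $\mathbb S^d$ carries the Euclidean metric. For $\mathbf{i}=i_1\ldots i_n$, $A_{\mathbf i}=A_{i_1}\cdots A_{i_n}$ and $\varphi_{\mathbf i}=\varphi_{A_{i_1}}\circ\cdots\circ\varphi_{A_{i_n}}$. $\Phi_{\mathcal{A}}$ satisfies the strong exponential separation condition on $J\subset\mathbb S^d$ if $\varphi_{\mathbf i}\equiv\varphi_{\mathbf j}$ only when $\mathbf i=\mathbf j$, and there is $c>0$ such that for all $n$ and all $\mathbf{i},\mathbf{j}\in\Lambda^n$ with $i_1\ne j_1$ and $\varphi_{\mathbf i}\not\equiv\varphi_{\mathbf j}$, $\sup_{x\in J}\|\varphi_{\mathbf i}(x)-\varphi_{\mathbf j}(x)\|>c^n$. $\mathcal{A}$ is strongly Diophantine if there is $c>0$ such that $\|A_{\mathbf i}-A_{\mathbf j}\|>c^n$ (operator norm) for all $n$ and all $\mathbf i\ne\mathbf j\in\Lambda^n$. *)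

theory Defs
  imports "HOL-Analysis.Analysis"
begin

text \<open>Projective action of a matrix on the unit sphere: phi_A(x) = Ax / |Ax|.\<close>
definition proj_act :: "real^'n^'n \<Rightarrow> real^'n \<Rightarrow> real^'n" where
  "proj_act M x = (1 / norm (M *v x)) *\<^sub>R (M *v x)"

text \<open>Product A_w = A_{w_1} ... A_{w_n} of a word w (a list of indices).\<close>
definition word_mat :: "('i \<Rightarrow> real^'n^'n) \<Rightarrow> 'i list \<Rightarrow> real^'n^'n" where
  "word_mat A w = foldr (\<lambda>i M. A i ** M) w (mat 1)"

text \<open>Composed map phi_w = phi_{A_{w_1}} o ... o phi_{A_{w_n}}.\<close>
definition word_map :: "('i \<Rightarrow> real^'n^'n) \<Rightarrow> 'i list \<Rightarrow> real^'n \<Rightarrow> real^'n" where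
  "word_map A w = foldr (\<lambda>i f. proj_act (A i) \<circ> f) w id"

text \<open>Words of length n over the alphabet Lambda.\<close>
definition words :: "'i set \<Rightarrow> nat \<Rightarrow> 'i list set" where
  "words \<Lambda> n = {w. set w \<subseteq> \<Lambda> \<and> length w = n}"

text \<open>Identity of maps on the unit sphere S^d.\<close>
definition same_on_sphere :: "(real^'n \<Rightarrow> real^'n) \<Rightarrow> (real^'n \<Rightarrow> real^'n) \<Rightarrow> bool" where
  "same_on_sphere f g \<longleftrightarrow> (\<forall>x\<in>sphere 0 1. f x = g x)"

definition strong_exp_sep :: "'i set \<Rightarrow> ('i \<Rightarrow> real^'n^'n) \<Rightarrow> (real^'n) set \<Rightarrow> bool" where
  "strong_exp_sep \<Lambda> A J \<longleftrightarrow>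
     (\<forall>v w. set v \<subseteq> \<Lambda> \<longrightarrow> set w \<subseteq> \<Lambda> \<longrightarrow>
        same_on_sphere (word_map A v) (word_map A w) \<longrightarrow> v = w) \<and>
     (\<exists>c>0. \<forall>n. \<forall>v\<in>words \<Lambda> n. \<forall>w\<in>words \<Lambda> n.
        hd v \<noteq> hd w \<longrightarrow> \<not> same_on_sphere (word_map A v) (word_map A w) \<longrightarrow>
        (SUP x\<in>J. norm (word_map A v x - word_map A w x)) > c ^ n)"

definition strongly_diophantine :: "'i set \<Rightarrow> ('i \<Rightarrow> real^'n^'n) \<Rightarrow> bool" where
  "strongly_diophantine \<Lambda> A \<longleftrightarrow>
     (\<exists>c>0. \<forall>n. \<forall>v\<in>words \<Lambda> n. \<forall>w\<in>words \<Lambda> n.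
        v \<noteq> w \<longrightarrow> onorm ((*v) (word_mat A v - word_mat A w)) > c ^ n)"

end

theory Submission
  imports Defs
begin

text \<open>Two distinct words of length n split as u v' and u w', where v' and w' (of length m)
  start with different letters. Strong exponential separation gives a point x of J at which
  the normalised vectors A_v' x and A_w' x are more than c^m apart. Invertibility gives
  \<beta> > 0 with |A_i y| \<ge> \<beta> |y| for all letters; as normalisation is (2/|a|)-Lipschitz at a,
  this yields |A_v' x - A_w' x| \<ge> \<beta>^m c^m / 2, and applying A_u costs at most another factor
  \<beta>^|u|. Taking c \<le> 1, the operator norm of A_v - A_w therefore exceeds (\<beta> c / 2)^n.\<close>

lemma proj_act_eq_sgn: "proj_act M x = sgn (M *v x)"
  by (simp add: proj_act_def sgn_div_norm divide_inverse_commute)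

lemma norm_proj_act_le_1: "norm (proj_act M x) \<le> 1"
  by (simp add: proj_act_eq_sgn norm_sgn)

text \<open>No invertibility is needed: if N x = 0, both sides are 0 because 1 / 0 = 0.\<close>
lemma proj_act_proj_act: "proj_act M (proj_act N x) = proj_act (M ** N) x"
proof (cases "N *v x = 0")
  case True
  then have "(M ** N) *v x = 0" by (metis matrix_vector_mul_assoc matrix_vector_mult_0_right)
  with True show ?thesis by (simp add: proj_act_def)
next
  case False
  then show ?thesis by (simp add: proj_act_def matrix_vector_mult_scaleR matrix_vector_mul_assoc)
qed

lemma word_mat_Cons: "word_mat A (i # w) = A i ** word_mat A w"
  by (simp add: word_mat_def)

lemma word_mat_append: "word_mat A (u @ v) = word_mat A u ** word_mat A v"
  by (induction u) (simp_all add: word_mat_def matrix_mul_assoc)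

lemma word_map_eq_proj_act:
  assumes "norm x = 1"
  shows "word_map A w x = proj_act (word_mat A w) x"
proof (induction w)
  case Nil
  then show ?case using assms by (simp add: word_map_def word_mat_def proj_act_def)
next
  case (Cons i w)
  then show ?case by (simp add: word_map_def word_mat_Cons proj_act_proj_act)
qed

lemma finite_invertible_uniform_norm_mult_le:
  fixes A :: "'i \<Rightarrow> real^'n^'n"
  assumes "finite \<Lambda>" "\<forall>i\<in>\<Lambda>. invertible (A i)"
  obtains \<beta> where "\<beta> > 0" "\<And>i (y::real^'n). i \<in> \<Lambda> \<Longrightarrow> \<beta> * norm y \<le> norm (A i *v y)"
proof -
  have "\<forall>i\<in>\<Lambda>. \<exists>b>0. \<forall>y::real^'n. b * norm y \<le> norm (A i *v y)"
    using assms(2) linear_inj_bounded_below_pos[OF matrix_vector_mul_linear]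
      matrix_left_invertible_injective unfolding invertible_def by metis
  then obtain b where b: "\<And>i. i \<in> \<Lambda> \<Longrightarrow> b i > 0 \<and> (\<forall>y. b i * norm y \<le> norm (A i *v y))"
    by metis
  define \<beta> where "\<beta> = Min (insert 1 (b ` \<Lambda>))"
  have fin: "finite (insert 1 (b ` \<Lambda>))" using assms(1) by simp
  show ?thesis
  proof
    show "\<beta> > 0" unfolding \<beta>_def using fin b by (subst Min_gr_iff) auto
    fix i and y :: "real^'n" assume i: "i \<in> \<Lambda>"
    have "\<beta> \<le> b i" unfolding \<beta>_def using fin i by simp
    then have "\<beta> * norm y \<le> b i * norm y" by (simp add: mult_right_mono)
    also have "\<dots> \<le> norm (A i *v y)" using b i by blast
    finally show "\<beta> * norm y \<le> norm (A i *v y)" .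
  qed
qed

lemma norm_word_mat_mult_le:
  fixes A :: "'i \<Rightarrow> real^'n^'n"
  assumes "\<And>i y. i \<in> \<Lambda> \<Longrightarrow> \<beta> * norm y \<le> norm (A i *v y)" "\<beta> \<ge> 0" "set w \<subseteq> \<Lambda>"
  shows "\<beta> ^ length w * norm y \<le> norm (word_mat A w *v y)"
  using assms(3)
proof (induction w arbitrary: y)
  case Nil
  then show ?case by (simp add: word_mat_def)
next
  case (Cons i w)
  have "\<beta> ^ length (i # w) * norm y \<le> \<beta> * norm (word_mat A w *v y)"
    using Cons assms(2) by (simp add: mult.assoc mult_left_mono)
  also have "\<dots> \<le> norm (A i *v (word_mat A w *v y))" using assms(1) Cons.prems by simp
  finally show ?case by (simp add: word_mat_Cons matrix_vector_mul_assoc)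
qed

lemma norm_sgn_diff_le:
  fixes a b :: "'a::real_normed_vector"
  assumes "a \<noteq> 0"
  shows "norm (sgn a - sgn b) \<le> 2 * norm (a - b) / norm a"
proof (cases "b = 0")
  case True
  then show ?thesis using assms by (simp add: norm_sgn)
next
  case False
  have "(norm b - norm a) / norm a / norm b = 1 / norm a - 1 / norm b"
    using assms False by (simp add: field_simps)
  then have "((norm b - norm a) / norm a) *\<^sub>R sgn b = (1 / norm a - 1 / norm b) *\<^sub>R b"
    by (metis divide_inverse_commute scaleR_scaleR sgn_div_norm times_divide_eq_right mult_1_right)
  then have eq: "sgn a - sgn b = (a - b) /\<^sub>R norm a + ((norm b - norm a) / norm a) *\<^sub>R sgn b"
    by (simp add: sgn_div_norm scaleR_diff_right scaleR_diff_left divide_inverse_commute)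
  have "norm (sgn a - sgn b)
      \<le> norm ((a - b) /\<^sub>R norm a) + norm (((norm b - norm a) / norm a) *\<^sub>R sgn b)"
    unfolding eq by (rule norm_triangle_ineq)
  also have "\<dots> = norm (a - b) / norm a + \<bar>norm b - norm a\<bar> / norm a"
    using False by (simp add: norm_sgn abs_mult divide_inverse_commute)
  also have "\<dots> \<le> 2 * norm (a - b) / norm a"
    using divide_right_mono[OF norm_triangle_ineq3[of b a], of "norm a"]
    by (simp add: norm_minus_commute)
  finally show ?thesis .
qed

lemma onorm_word_mat_diff_ge:
  fixes A :: "'i \<Rightarrow> real^'n^'n"
  assumes lower: "\<And>i y. i \<in> \<Lambda> \<Longrightarrow> \<beta> * norm y \<le> norm (A i *v y)" and "\<beta> > 0"
    and "set u \<subseteq> \<Lambda>" "set v \<subseteq> \<Lambda>" and "norm x = 1"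
  shows "\<beta> ^ (length u + length v) / 2 * norm (proj_act (word_mat A v) x - proj_act (word_mat A w) x)
    \<le> onorm ((*v) (word_mat A (u @ v) - word_mat A (u @ w)))"
proof -
  define a where "a = word_mat A v *v x"
  define b where "b = word_mat A w *v x"
  have a_ge: "\<beta> ^ length v \<le> norm a"
    using norm_word_mat_mult_le[OF lower, where w = v and y = x] assms by (simp add: a_def)
  then have a_pos: "norm a > 0" using assms(2) by (meson less_le_trans zero_less_power)
  have "\<beta> ^ length v / 2 * norm (sgn a - sgn b) \<le> norm a / 2 * (2 * norm (a - b) / norm a)"
    using a_ge norm_sgn_diff_le[of a b] a_pos
    by (intro mult_mono) (auto simp: divide_right_mono)
  also have "\<dots> = norm (a - b)" using a_pos by simp
  finally have ab: "\<beta> ^ length v / 2 * norm (sgn a - sgn b) \<le> norm (a - b)" .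
  have "\<beta> ^ (length u + length v) / 2 * norm (sgn a - sgn b) \<le> \<beta> ^ length u * norm (a - b)"
    using mult_left_mono[OF ab, of "\<beta> ^ length u"] assms(2) by (simp add: power_add)
  also have "\<dots> \<le> norm (word_mat A u *v (a - b))"
    using norm_word_mat_mult_le[OF lower] assms by simp
  also have "word_mat A u *v (a - b) = (word_mat A (u @ v) - word_mat A (u @ w)) *v x"
    by (simp add: word_mat_append a_def b_def matrix_vector_mul_assoc
        matrix_vector_mult_diff_distrib matrix_vector_mult_diff_rdistrib)
  also have "norm \<dots> \<le> onorm ((*v) (word_mat A (u @ v) - word_mat A (u @ w)))"
    using onorm[of "(*v) (word_mat A (u @ v) - word_mat A (u @ w))" x] assms(5) by simp
  finally show ?thesis by (simp add: a_def b_def proj_act_eq_sgn)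
qed

lemma strong_exp_sep_separating_point:
  assumes "J \<subseteq> sphere 0 1" "J \<noteq> {}" "strong_exp_sep \<Lambda> A J"
  obtains c where "0 < c" "c \<le> 1"
    "\<And>m v w. v \<in> words \<Lambda> m \<Longrightarrow> w \<in> words \<Lambda> m \<Longrightarrow> hd v \<noteq> hd w \<Longrightarrow>
      \<exists>x\<in>J. c ^ m < norm (proj_act (word_mat A v) x - proj_act (word_mat A w) x)"
proof -
  obtain c where "c > 0" and sep: "\<forall>m. \<forall>v\<in>words \<Lambda> m. \<forall>w\<in>words \<Lambda> m.
      hd v \<noteq> hd w \<longrightarrow> \<not> same_on_sphere (word_map A v) (word_map A w) \<longrightarrow>
      (SUP x\<in>J. norm (word_map A v x - word_map A w x)) > c ^ m"
    using conjunct2[OF assms(3)[unfolded strong_exp_sep_def]] by (elim exE conjE)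
  have inj: "\<And>v w. set v \<subseteq> \<Lambda> \<Longrightarrow> set w \<subseteq> \<Lambda> \<Longrightarrow>
      same_on_sphere (word_map A v) (word_map A w) \<Longrightarrow> v = w"
    using conjunct1[OF assms(3)[unfolded strong_exp_sep_def]] by blast
  have on_J: "word_map A v x = proj_act (word_mat A v) x" if "x \<in> J" for v x
    by (rule word_map_eq_proj_act) (use assms(1) that in auto)
  show ?thesis
  proof (rule that[of "min c 1"])
    show "0 < min c 1" "min c 1 \<le> 1" using \<open>c > 0\<close> by auto
    fix m v w assume v: "v \<in> words \<Lambda> m" and w: "w \<in> words \<Lambda> m" and hd: "hd v \<noteq> hd w"
    let ?d = "\<lambda>x. norm (proj_act (word_mat A v) x - proj_act (word_mat A w) x)"
    have "\<not> same_on_sphere (word_map A v) (word_map A w)"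
      using inj v w hd by (auto simp: words_def)
    then have "c ^ m < (SUP x\<in>J. ?d x)"
      using sep v w hd on_J by (simp cong: SUP_cong)
    moreover have "min c 1 ^ m \<le> c ^ m" using \<open>c > 0\<close> by (intro power_mono) auto
    moreover have "bdd_above (?d ` J)"
    proof (rule bdd_aboveI2)
      fix x
      show "?d x \<le> 2"
        using add_mono[OF norm_proj_act_le_1 norm_proj_act_le_1] by (intro norm_triangle_le_diff) simp
    qed
    ultimately show "\<exists>x\<in>J. min c 1 ^ m < ?d x" using less_cSUP_iff[OF assms(2)] by force
  qed
qed

lemma power_mult_half_le:
  fixes \<beta> c :: real
  assumes "\<beta> > 0" "0 < c" "c \<le> 1" "1 \<le> m" "m \<le> n"
  shows "(\<beta> * c / 2) ^ n \<le> \<beta> ^ n / 2 * c ^ m"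
proof -
  have "(2::real) \<le> 2 ^ n" using assms(4,5) by (intro self_le_power) auto
  have "(\<beta> * c / 2) ^ n = \<beta> ^ n * c ^ n / 2 ^ n" by (simp add: power_mult_distrib power_divide)
  also have "\<dots> \<le> \<beta> ^ n * c ^ m / 2"
    using assms \<open>2 \<le> 2 ^ n\<close> by (intro frac_le mult_left_mono power_decreasing) auto
  finally show ?thesis by simp
qed

lemma same_length_neq_first_difference:
  assumes "length v = length w" "v \<noteq> w"
  obtains u v' w' where "v = u @ v'" "w = u @ w'" "length v' = length w'" "v' \<noteq> []" "hd v' \<noteq> hd w'"
proof -
  obtain u v' w' where uvw: "v = u @ v'" "w = u @ w'" "v' = [] \<or> w' = [] \<or> hd v' \<noteq> hd w'"
    using longest_common_prefix by blast
  moreover have "length v' = length w'" using uvw assms(1) by simp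
  ultimately have "v' \<noteq> []" "hd v' \<noteq> hd w'" using assms(2) by auto
  then show ?thesis using that uvw \<open>length v' = length w'\<close> by blast
qed

theorem proposition2p2:
  fixes \<Lambda> :: "'i set" and A :: "'i \<Rightarrow> real^'n^'n" and J :: "(real^'n) set"
  assumes "finite \<Lambda>"
    and "\<forall>i\<in>\<Lambda>. invertible (A i)"
    and "J \<subseteq> sphere 0 1" and "J \<noteq> {}"
    and "strong_exp_sep \<Lambda> A J"
  shows "strongly_diophantine \<Lambda> A"
proof -
  obtain \<beta> where "\<beta> > 0" and lower: "\<And>i y. i \<in> \<Lambda> \<Longrightarrow> \<beta> * norm y \<le> norm (A i *v y)"
    using finite_invertible_uniform_norm_mult_le assms(1,2) by blast
  obtain c where c: "0 < c" "c \<le> 1" and sep: "\<And>m v w. v \<in> words \<Lambda> m \<Longrightarrow> w \<in> words \<Lambda> m \<Longrightarrow>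
      hd v \<noteq> hd w \<Longrightarrow> \<exists>x\<in>J. c ^ m < norm (proj_act (word_mat A v) x - proj_act (word_mat A w) x)"
    using strong_exp_sep_separating_point assms(3-5) by blast
  show ?thesis unfolding strongly_diophantine_def
  proof (intro exI[of _ "\<beta> * c / 2"] conjI allI ballI impI)
    show "\<beta> * c / 2 > 0" using \<open>\<beta> > 0\<close> c by simp
    fix n v w assume "v \<in> words \<Lambda> n" "w \<in> words \<Lambda> n" "v \<noteq> w"
    then have v: "set v \<subseteq> \<Lambda>" "length v = n" and w: "set w \<subseteq> \<Lambda>" "length w = n"
      by (auto simp: words_def)
    obtain u v' w' where vw: "v = u @ v'" "w = u @ w'" "length v' = length w'"
        and "v' \<noteq> []" "hd v' \<noteq> hd w'"
      using same_length_neq_first_difference[of v w] v w \<open>v \<noteq> w\<close> by metis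
    let ?m = "length v'"
    have n: "n = length u + ?m" using v vw by simp
    have "?m \<ge> 1" using \<open>v' \<noteq> []\<close> by (simp add: Suc_le_eq)
    have "v' \<in> words \<Lambda> ?m" "w' \<in> words \<Lambda> ?m" using v w vw by (auto simp: words_def)
    then obtain x where x: "x \<in> J"
      and far: "c ^ ?m < norm (proj_act (word_mat A v') x - proj_act (word_mat A w') x)"
      using sep \<open>hd v' \<noteq> hd w'\<close> by blast
    have "(\<beta> * c / 2) ^ n \<le> \<beta> ^ n / 2 * c ^ ?m"
      using \<open>\<beta> > 0\<close> c \<open>?m \<ge> 1\<close> n by (intro power_mult_half_le) auto
    also have "\<dots> < \<beta> ^ n / 2 * norm (proj_act (word_mat A v') x - proj_act (word_mat A w') x)"
      using far \<open>\<beta> > 0\<close> by simp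
    also have "\<dots> \<le> onorm ((*v) (word_mat A v - word_mat A w))"
      using onorm_word_mat_diff_ge[OF lower \<open>\<beta> > 0\<close>, where u = u and v = v' and w = w']
        v vw x assms(3) n by auto
    finally show "(\<beta> * c / 2) ^ n < onorm ((*v) (word_mat A v - word_mat A w))" .
  qed
qed

end
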